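(* Let $\tilde{\mathcal G}=(\tilde V,\tilde E)$ be a finite, undirected, connected graph without self-loops, with reference vertex $\delta\in\tilde V$, $V=\tilde V\setminus\{\delta\}$, and positive symmetric edge weights $W$. For all $\lambda\in\Lambda_V$, the image of the $H^{2|2}$ measure $\mu^{W^\lambda}$ under the transformation $S_\lambda$ is given by $$S_\lambda\mu^{W^\lambda}(du\,ds)=\prod_{(i\sim j)\in\tilde E}e^{W^\lambda_{ij}-W_{ij}}\cdot\prod_{j\in V}\sqrt{1+\lambda_j}\,e^{-\lambda_j\beta^W_j(u)}\,\mu^W(du\,ds)$$ $$=\prod_{(i\sim j)\in\tilde E}e^{W_{ij}\left(\sqrt{1+\lambda_i}\sqrt{1+\lambda_j}-1\right)}\cdot\prod_{j\in V}\sqrt{1+\lambda_j}\,e^{-\lambda_j\beta^W_j(u)}\,\mu^W(du\,ds).$$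
   Context: Weights: $W_{ij}=W_{ji}>0$ for every undirected edge $(i\sim j)\in\tilde E$ and $W_{ij}=0$ if $i\not\sim j$. Products over $(i\sim j)\in\tilde E$ run over undirected edges, each counted once. $U_V=\{u\in\mathbb{R}^{\tilde V}: u_\delta=0\}$, $\Omega_V=U_V\times U_V$ with elements $(u,s)$. For $u\in U_V$, $A^W(u)\in\mathbb{R}^{\tilde V\times\tilde V}$ has entries $A^W_{ij}(u)=-W_{ij}e^{u_i+u_j}$ for $i\ne j$ and $A^W_{ii}(u)=\sum_{k\in\tilde V}W_{ik}e^{u_i+u_k}$; $A^W_{VV}(u)$ is obtained by deleting row and column $\delta$. The $H^{2|2}$ measure with weights $W$ is the probability measure on $\Omega_V$ $$\mu^W(du\,ds)=e^{-\frac12 s^tA^W(u)s}\,\det A^W_{VV}(u)\prod_{(i\sim j)\in\tilde E}e^{-W_{ij}[\cosh(u_i-u_j)-1]}\prod_{i\in V}e^{-u_i}\frac{du_i\,ds_i}{2\pi}$$ (known to have total mass 1). $\beta^W_i(u)=\frac12\sum_{j\in\tilde V:\,j\sim i}W_{ij}e^{u_j-u_i}$ for $i\in V$. $\Lambda_V=\{\lambda\in(-1,\infty)^{\tilde V}:\lambda_\delta=0\}$. For $\lambda\in\Lambda_V$: rescaled weights $W^\lambda_{ij}=\sqrt{1+\lambda_i}\sqrt{1+\lambda_j}\,W_{ij}$, and the local shift $S_\lambda:\Omega_V\to\Omega_V$, $(\tilde u,s)\mapsto(u,s)$ with $u_i=\tilde u_i+\log\sqrt{1+\lambda_i}$ for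 all $i\in\tilde V$. $S_\lambda\mu$ denotes the image (push-forward) measure of $\mu$ under $S_\lambda$. *)

theory Defs
  imports "HOL-Analysis.Analysis" "Graph_Theory.Digraph_Component"
begin

text \<open>
  Finite simple undirected graphs are represented by the symmetric digraphs of the locale
  \<^locale>\<open>pair_graph\<close>: each undirected edge corresponds to its two opposite arcs. A function on the
  vertex set is extensional, i.e. equal to \<^const>\<open>undefined\<close> outside \<^term>\<open>pverts G\<close>.
\<close>

definition undirected_edges :: "'v pair_pre_digraph \<Rightarrow> 'v set set" where
  "undirected_edges G = {{i, j} | i j. (i, j) \<in> parcs G}"

text \<open>
  Product over undirected edges of a quantity \<open>f i j\<close> that is symmetric in the two endpoints,
  so that the definite description denotes the common value \<open>f i j = f j i\<close>.
\<close>

definition edge_prod :: "'v pair_pre_digraph \<Rightarrow> ('v \<Rightarrow> 'v \<Rightarrow> real) \<Rightarrow> real" where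
  "edge_prod G f = (\<Prod>e\<in>undirected_edges G. THE y. \<exists>i j. e = {i, j} \<and> y = f i j)"

lemma edge_factor_eq:
  fixes f :: "'v \<Rightarrow> 'v \<Rightarrow> real"
  assumes "f i j = f j i"
  shows "(THE y. \<exists>i' j'. {i, j} = {i', j'} \<and> y = f i' j') = f i j"
  by (rule the_equality) (use assms in \<open>auto simp: doubleton_eq_iff\<close>)

text \<open>Leibniz formula for the determinant of the submatrix with rows and columns indexed by \<open>I\<close>.\<close>

definition det_on :: "'v set \<Rightarrow> ('v \<Rightarrow> 'v \<Rightarrow> real) \<Rightarrow> real" where
  "det_on I A = (\<Sum>p | p permutes I. of_int (sign p) * (\<Prod>i\<in>I. A i (p i)))"

lemma det_on_UNIV: "det A = det_on UNIV (\<lambda>i j. A $ i $ j)"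
  by (simp add: det_def det_on_def)

definition edge_weights :: "'v pair_pre_digraph \<Rightarrow> ('v \<Rightarrow> 'v \<Rightarrow> real) \<Rightarrow> bool" where
  "edge_weights G W \<longleftrightarrow>
    (\<forall>i\<in>pverts G. \<forall>j\<in>pverts G.
       W i j = W j i \<and>
       ((i, j) \<in> parcs G \<longrightarrow> 0 < W i j) \<and>
       ((i, j) \<notin> parcs G \<longrightarrow> W i j = 0))"

definition non_ref :: "'v pair_pre_digraph \<Rightarrow> 'v \<Rightarrow> 'v set" where
  "non_ref G \<delta> = pverts G - {\<delta>}"

definition U_space :: "'v pair_pre_digraph \<Rightarrow> 'v \<Rightarrow> ('v \<Rightarrow> real) set" where
  "U_space G \<delta> = {u \<in> pverts G \<rightarrow>\<^sub>E UNIV. u \<delta> = 0}"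

text \<open>
  The reference measure \<open>\<Prod>\<^bsub>i\<noteq>\<delta>\<^esub> du\<^sub>i\<close>: product Lebesgue measure in the coordinates other than \<open>\<delta>\<close>,
  transported to \<^const>\<open>U_space\<close> by inserting the coordinate \<open>u \<delta> = 0\<close>.
\<close>

definition lebesgue_U :: "'v pair_pre_digraph \<Rightarrow> 'v \<Rightarrow> ('v \<Rightarrow> real) measure" where
  "lebesgue_U G \<delta> =
    distr (\<Pi>\<^sub>M i\<in>non_ref G \<delta>. lborel)
      (restrict_space (\<Pi>\<^sub>M i\<in>pverts G. borel) (U_space G \<delta>))
      (\<lambda>x. x(\<delta> := 0))"

definition lebesgue_Omega ::
    "'v pair_pre_digraph \<Rightarrow> 'v \<Rightarrow> (('v \<Rightarrow> real) \<times> ('v \<Rightarrow> real)) measure" where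
  "lebesgue_Omega G \<delta> = lebesgue_U G \<delta> \<Otimes>\<^sub>M lebesgue_U G \<delta>"

definition A_matrix ::
    "'v pair_pre_digraph \<Rightarrow> ('v \<Rightarrow> 'v \<Rightarrow> real) \<Rightarrow> ('v \<Rightarrow> real) \<Rightarrow> 'v \<Rightarrow> 'v \<Rightarrow> real" where
  "A_matrix G W u i j =
    (if i = j then \<Sum>k\<in>pverts G. W i k * exp (u i + u k)
     else - W i j * exp (u i + u j))"

definition H22_density ::
    "'v pair_pre_digraph \<Rightarrow> 'v \<Rightarrow> ('v \<Rightarrow> 'v \<Rightarrow> real) \<Rightarrow> ('v \<Rightarrow> real) \<times> ('v \<Rightarrow> real) \<Rightarrow> real" where
  "H22_density G \<delta> W = (\<lambda>(u, s).
     exp (- (1 / 2) * (\<Sum>i\<in>pverts G. \<Sum>j\<in>pverts G. s i * A_matrix G W u i j * s j))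
     * det_on (non_ref G \<delta>) (A_matrix G W u)
     * edge_prod G (\<lambda>i j. exp (- W i j * (cosh (u i - u j) - 1)))
     * (\<Prod>i\<in>non_ref G \<delta>. exp (- u i) / (2 * pi)))"

definition H22_measure ::
    "'v pair_pre_digraph \<Rightarrow> 'v \<Rightarrow> ('v \<Rightarrow> 'v \<Rightarrow> real) \<Rightarrow> (('v \<Rightarrow> real) \<times> ('v \<Rightarrow> real)) measure" where
  "H22_measure G \<delta> W = density (lebesgue_Omega G \<delta>) (\<lambda>x. ennreal (H22_density G \<delta> W x))"

definition beta ::
    "'v pair_pre_digraph \<Rightarrow> ('v \<Rightarrow> 'v \<Rightarrow> real) \<Rightarrow> 'v \<Rightarrow> ('v \<Rightarrow> real) \<Rightarrow> real" where
  "beta G W i u = 1 / 2 * (\<Sum>j | j \<in> pverts G \<and> (i, j) \<in> parcs G. W i j * exp (u j - u i))"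

definition shift_params :: "'v pair_pre_digraph \<Rightarrow> 'v \<Rightarrow> ('v \<Rightarrow> real) set" where
  "shift_params G \<delta> = {l \<in> pverts G \<rightarrow>\<^sub>E {-1<..}. l \<delta> = 0}"

definition rescaled_weights :: "('v \<Rightarrow> real) \<Rightarrow> ('v \<Rightarrow> 'v \<Rightarrow> real) \<Rightarrow> 'v \<Rightarrow> 'v \<Rightarrow> real" where
  "rescaled_weights l W i j = sqrt (1 + l i) * sqrt (1 + l j) * W i j"

definition local_shift ::
    "'v pair_pre_digraph \<Rightarrow> ('v \<Rightarrow> real) \<Rightarrow>
      ('v \<Rightarrow> real) \<times> ('v \<Rightarrow> real) \<Rightarrow> ('v \<Rightarrow> real) \<times> ('v \<Rightarrow> real)" where
  "local_shift G l = (\<lambda>(u, s). (\<lambda>i\<in>pverts G. u i + ln (sqrt (1 + l i)), s))"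

end

theory Submission
  imports Defs
begin

text \<open>
  Write \<open>u = v + ln (sqrt (1 + \<lambda>))\<close> for the image of \<open>v\<close> under the local shift. Then
  \<open>W\<^sup>\<lambda>\<^sub>i\<^sub>j exp (v\<^sub>i + v\<^sub>j) = W\<^sub>i\<^sub>j exp (u\<^sub>i + u\<^sub>j)\<close>, so the matrix \<open>A\<close>, and with it the
  Gaussian and the determinant in the density, is carried over unchanged (\<open>A_matrix_rescaled\<close>).
  Only two kinds of factors change. Each \<open>exp (- v\<^sub>i)\<close> equals \<open>sqrt (1 + \<lambda>\<^sub>i) exp (- u\<^sub>i)\<close>. In
  \<open>W\<^sup>\<lambda>\<^sub>i\<^sub>j cosh (v\<^sub>i - v\<^sub>j)\<close> the two exponentials that make up \<open>cosh (u\<^sub>i - u\<^sub>j)\<close> are scaled separately,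
  by \<open>1 + \<lambda>\<^sub>j\<close> and \<open>1 + \<lambda>\<^sub>i\<close> (\<open>cosh_rescaled\<close>). The excess over \<open>W\<^sub>i\<^sub>j cosh (u\<^sub>i - u\<^sub>j)\<close> attaches
  a term \<open>\<lambda>\<^sub>i W\<^sub>i\<^sub>j exp (u\<^sub>j - u\<^sub>i) / 2\<close> to each directed edge, and collecting these by their tail \<open>i\<close>
  gives \<open>\<lambda>\<^sub>i \<beta>\<^sub>i(u)\<close>. The constants subtracted from the \<open>cosh\<close> terms leave
  \<open>exp (W\<^sup>\<lambda>\<^sub>i\<^sub>j - W\<^sub>i\<^sub>j)\<close> on each edge (\<open>edge_prod_cosh_rescaled\<close>).

  The reference measure is invariant under the shift, because the shift translates the free
  coordinates and fixes the coordinate of the reference vertex, where \<open>\<lambda>\<close> vanishes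
  (\<open>distr_lebesgue_Omega_local_shift\<close>). Hence the image measure has the density just computed,
  with no further Jacobian.
\<close>

section \<open>Products over undirected edges\<close>

text \<open>
  Each undirected edge consists of two distinct opposite arcs. Splitting the exponent of an edge
  factor into one share per arc turns the edge product into the exponential of an ordinary sum; the
  split may be asymmetric in the two endpoints, which is what lets a term be charged to the tail of
  an arc only.
\<close>

lemma edge_prod_exp:
  assumes G: "pair_graph G"
    and f: "\<And>i j. (i, j) \<in> parcs G \<Longrightarrow> f i j = exp (h i j + h j i)"
  shows "edge_prod G f = exp (\<Sum>(i, j)\<in>parcs G. h i j)"
proof -
  interpret pair_graph G by (rule G)
  define edge where "edge = (\<lambda>(i :: 'a, j). {i, j})"
  have opposite: "(j, i) \<in> parcs G" if "(i, j) \<in> parcs G" for i j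
    using that pair_sym_arcs by (auto simp: symmetric_def elim: symE)
  have edges: "undirected_edges G = edge ` parcs G"
    by (force simp: undirected_edges_def edge_def)
  have factor: "(THE y. \<exists>i j. e = {i, j} \<and> y = f i j)
      = exp (\<Sum>(i, j) | (i, j) \<in> parcs G \<and> edge (i, j) = e. h i j)"
    if e: "e \<in> undirected_edges G" for e
  proof -
    obtain a b where ab: "e = {a, b}" "(a, b) \<in> parcs G"
      using e by (auto simp: undirected_edges_def)
    have ne: "a \<noteq> b" using pair_no_loops[OF ab(2)] by simp
    have arcs: "{(i, j). (i, j) \<in> parcs G \<and> edge (i, j) = e} = {(a, b), (b, a)}"
      using ab opposite by (auto simp: edge_def doubleton_eq_iff)
    have "f a b = f b a"
      using f[OF ab(2)] f[OF opposite[OF ab(2)]] by (simp add: add.commute)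
    then show ?thesis
      using ne f[OF ab(2)] unfolding arcs by (simp add: ab(1) edge_factor_eq)
  qed
  have "edge_prod G f
      = (\<Prod>e\<in>undirected_edges G. exp (\<Sum>(i, j) | (i, j) \<in> parcs G \<and> edge (i, j) = e. h i j))"
    unfolding edge_prod_def by (rule prod.cong[OF refl factor])
  also have "\<dots> = exp (\<Sum>e\<in>edge ` parcs G. \<Sum>(i, j) | (i, j) \<in> parcs G \<and> edge (i, j) = e. h i j)"
    by (simp add: exp_sum pair_finite_arcs edges)
  also have "\<dots> = exp (\<Sum>(i, j)\<in>parcs G. h i j)"
    by (subst sum.image_gen[OF pair_finite_arcs, of _ edge])
       (simp add: case_prod_unfold)
  finally show ?thesis .
qed

lemma edge_prod_exp_symmetric:
  assumes "pair_graph G" and sym: "\<And>i j. (i, j) \<in> parcs G \<Longrightarrow> g i j = g j i"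
  shows "edge_prod G (\<lambda>i j. exp (g i j)) = exp (\<Sum>(i, j)\<in>parcs G. g i j / 2)"
proof (rule edge_prod_exp[OF assms(1)])
  show "exp (g i j) = exp (g i j / 2 + g j i / 2)" if "(i, j) \<in> parcs G" for i j
    using sym[OF that] by simp
qed

lemma edge_weights_sym:
  "W i j = W j i" if "pair_graph G" "edge_weights G W" "(i, j) \<in> parcs G"
proof -
  interpret pair_graph G by (rule that)
  show ?thesis
    using that in_arcsD1[OF that(3)] in_arcsD2[OF that(3)] by (auto simp: edge_weights_def)
qed

lemma rescaled_weights_sym:
  "rescaled_weights l W i j = rescaled_weights l W j i"
  if "pair_graph G" "edge_weights G W" "(i, j) \<in> parcs G"
  using edge_weights_sym[OF that] by (simp add: rescaled_weights_def)


section \<open>Invariance of the reference measure\<close>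

lemma distr_PiM_lborel_plus:
  fixes c :: "'i \<Rightarrow> real"
  assumes I: "finite I"
  shows "distr (\<Pi>\<^sub>M i\<in>I. lborel) (\<Pi>\<^sub>M i\<in>I. lborel) (\<lambda>x. \<lambda>i\<in>I. x i + c i) = (\<Pi>\<^sub>M i\<in>I. lborel)"
proof -
  interpret product_sigma_finite "\<lambda>_ :: 'i. lborel :: real measure" by standard
  let ?P = "\<Pi>\<^sub>M i\<in>I. lborel :: real measure" and ?T = "\<lambda>x. \<lambda>i\<in>I. x i + c i"
  have T: "?T \<in> measurable ?P ?P" by measurable
  show ?thesis
  proof (rule PiM_eqI[OF I])
    fix A :: "'i \<Rightarrow> real set"
    assume A: "\<And>i. i \<in> I \<Longrightarrow> A i \<in> sets lborel"
    have vimage: "?T -` Pi\<^sub>E I A \<inter> space ?P = (\<Pi>\<^sub>E i\<in>I. (+) (c i) -` A i)"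
      by (fastforce simp: space_PiM PiE_iff extensional_def add.commute)
    have shift_sets: "(+) (c i) -` A i \<in> sets lborel" if "i \<in> I" for i
      using measurable_sets[of "(+) (c i)" borel borel "A i"] A[OF that] by simp
    have "emeasure (distr ?P ?P ?T) (Pi\<^sub>E I A) = emeasure ?P (\<Pi>\<^sub>E i\<in>I. (+) (c i) -` A i)"
      using A by (subst emeasure_distr[OF T]) (auto simp: vimage intro!: sets_PiM_I_finite I)
    also have "\<dots> = (\<Prod>i\<in>I. emeasure lborel ((+) (c i) -` A i))"
      by (rule emeasure_PiM[OF I shift_sets])
    also have "\<dots> = (\<Prod>i\<in>I. emeasure lborel (A i))"
    proof (rule prod.cong[OF refl])
      fix i assume "i \<in> I"
      then have "emeasure (distr lborel borel ((+) (c i))) (A i) = emeasure lborel ((+) (c i) -` A i)"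
        using A by (subst emeasure_distr) auto
      then show "emeasure lborel ((+) (c i) -` A i) = emeasure lborel (A i)"
        by (simp add: lborel_distr_plus)
    qed
    finally show "emeasure (distr ?P ?P ?T) (Pi\<^sub>E I A) = (\<Prod>i\<in>I. emeasure lborel (A i))" .
  qed simp
qed

lemma space_lebesgue_U: "space (lebesgue_U G \<delta>) = U_space G \<delta>"
  by (auto simp: lebesgue_U_def space_restrict_space space_PiM U_space_def)

lemma measurable_insert_ref:
  assumes "\<delta> \<in> pverts G"
  shows "(\<lambda>x. x(\<delta> := 0)) \<in> measurable (\<Pi>\<^sub>M i\<in>non_ref G \<delta>. lborel)
    (restrict_space (\<Pi>\<^sub>M i\<in>pverts G. borel) (U_space G \<delta>))"
proof (rule measurable_restrict_space2)
  show "(\<lambda>x. x(\<delta> := 0)) \<in> space (\<Pi>\<^sub>M i\<in>non_ref G \<delta>. lborel :: real measure) \<rightarrow> U_space G \<delta>"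
    using assms by (auto simp: space_PiM U_space_def non_ref_def PiE_iff extensional_def)
  have ins: "pverts G = insert \<delta> (non_ref G \<delta>)"
    using assms by (auto simp: non_ref_def)
  have "(\<lambda>x. x(\<delta> := 0)) \<in> measurable (\<Pi>\<^sub>M i\<in>non_ref G \<delta>. borel)
      (\<Pi>\<^sub>M i\<in>insert \<delta> (non_ref G \<delta>). borel :: real measure)"
    by (rule measurable_fun_upd[where J = "non_ref G \<delta>"]) auto
  then show "(\<lambda>x. x(\<delta> := 0)) \<in> measurable (\<Pi>\<^sub>M i\<in>non_ref G \<delta>. lborel)
      (\<Pi>\<^sub>M i\<in>pverts G. borel :: real measure)"
    unfolding ins by (simp cong: measurable_cong_sets sets_PiM_cong)
qed

text \<open>
  Restricting to the free coordinates undoes the insertion of the reference coordinate, hence maps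
  the measure back to the sigma-finite product measure; sigma-finiteness pulls back along this map.
\<close>

lemma sigma_finite_lebesgue_U:
  assumes "pair_graph G" "\<delta> \<in> pverts G"
  shows "sigma_finite_measure (lebesgue_U G \<delta>)"
proof -
  interpret pair_graph G by (rule assms(1))
  let ?I = "non_ref G \<delta>"
  let ?P = "\<Pi>\<^sub>M i\<in>?I. lborel :: real measure"
  interpret finite_product_sigma_finite "\<lambda>_. lborel :: real measure" ?I
    by standard (simp add: non_ref_def pair_finite_verts)
  have R: "(\<lambda>u. restrict u ?I) \<in> measurable (lebesgue_U G \<delta>) ?P"
  proof -
    have "(\<lambda>u. restrict u ?I) \<in> measurable (\<Pi>\<^sub>M i\<in>pverts G. borel) (\<Pi>\<^sub>M i\<in>?I. borel :: real measure)"
      by (rule measurable_restrict_subset) (auto simp: non_ref_def)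
    then have "(\<lambda>u. restrict u ?I)
        \<in> measurable (restrict_space (\<Pi>\<^sub>M i\<in>pverts G. borel) (U_space G \<delta>)) (\<Pi>\<^sub>M i\<in>?I. borel :: real measure)"
      by (rule measurable_restrict_space1)
    then show ?thesis
      by (simp add: lebesgue_U_def cong: measurable_cong_sets sets_PiM_cong)
  qed
  have "distr (lebesgue_U G \<delta>) ?P (\<lambda>u. restrict u ?I) = distr ?P ?P (\<lambda>x. restrict (x(\<delta> := 0)) ?I)"
    using R unfolding lebesgue_U_def
    by (subst distr_distr) (auto simp: measurable_insert_ref[OF assms(2)] comp_def)
  also have "\<dots> = distr ?P ?P (\<lambda>x. x)"
    by (rule distr_cong) (auto simp: space_PiM PiE_iff non_ref_def extensional_def)
  also have "\<dots> = ?P" by simp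
  finally have "distr (lebesgue_U G \<delta>) ?P (\<lambda>u. restrict u ?I) = ?P" .
  then show ?thesis
    using sigma_finite_measure_distr[OF _ R] sigma_finite_measure_axioms by simp
qed

lemma measurable_component_lebesgue_U [measurable]:
  assumes "i \<in> pverts G"
  shows "(\<lambda>u. u i) \<in> borel_measurable (lebesgue_U G \<delta>)"
  using assms unfolding lebesgue_U_def
  by (simp add: measurable_restrict_space1)

lemma measurable_translate_U:
  assumes "c \<delta> = 0" "\<delta> \<in> pverts G"
  shows "(\<lambda>u. \<lambda>i\<in>pverts G. u i + c i) \<in> measurable (lebesgue_U G \<delta>) (lebesgue_U G \<delta>)"
proof -
  have "(\<lambda>u. \<lambda>i\<in>pverts G. u i + c i) \<in> measurable (lebesgue_U G \<delta>) (\<Pi>\<^sub>M i\<in>pverts G. borel)"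
    by measurable
  moreover have "(\<lambda>u. \<lambda>i\<in>pverts G. u i + c i) \<in> space (lebesgue_U G \<delta>) \<rightarrow> U_space G \<delta>"
    using assms by (auto simp: space_lebesgue_U U_space_def)
  ultimately have "(\<lambda>u. \<lambda>i\<in>pverts G. u i + c i)
      \<in> measurable (lebesgue_U G \<delta>) (restrict_space (\<Pi>\<^sub>M i\<in>pverts G. borel) (U_space G \<delta>))"
    by (intro measurable_restrict_space2)
  then show ?thesis
    by (rule measurable_cong_sets[THEN equalityD1, THEN subsetD, rotated -1])
       (simp_all add: lebesgue_U_def)
qed

text \<open>
  Translating after inserting the reference coordinate is the same as translating the free
  coordinates first, since \<open>c \<delta> = 0\<close>; the claim reduces to translation invariance of the product
  measure.
\<close>

lemma distr_lebesgue_U_translate: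
  assumes "pair_graph G" "\<delta> \<in> pverts G" "c \<delta> = 0"
  shows "distr (lebesgue_U G \<delta>) (lebesgue_U G \<delta>) (\<lambda>u. \<lambda>i\<in>pverts G. u i + c i) = lebesgue_U G \<delta>"
proof -
  interpret pair_graph G by (rule assms(1))
  let ?I = "non_ref G \<delta>" and ?V = "pverts G"
  let ?P = "\<Pi>\<^sub>M i\<in>?I. lborel :: real measure"
  let ?R = "restrict_space (\<Pi>\<^sub>M i\<in>?V. borel) (U_space G \<delta>) :: ('a \<Rightarrow> real) measure"
  let ?T = "\<lambda>u. \<lambda>i\<in>?V. u i + c i" and ?S = "\<lambda>x. \<lambda>i\<in>?I. x i + c i"
  let ?emb = "\<lambda>x :: 'a \<Rightarrow> real. x(\<delta> := 0)"
  note emb = measurable_insert_ref[OF assms(2)]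
  have T: "?T \<in> measurable ?R ?R"
    using measurable_translate_U[of c \<delta> G, OF assms(3,2)]
    by (simp add: lebesgue_U_def cong: measurable_cong_sets)
  have S: "?S \<in> measurable ?P ?P" by measurable
  have "distr (lebesgue_U G \<delta>) (lebesgue_U G \<delta>) ?T = distr (distr ?P ?R ?emb) ?R ?T"
    by (rule distr_cong) (simp_all add: lebesgue_U_def)
  also have "\<dots> = distr ?P ?R (?T \<circ> ?emb)"
    by (rule distr_distr[OF T emb])
  also have "\<dots> = distr ?P ?R (?emb \<circ> ?S)"
    using assms(2,3)
    by (intro distr_cong refl) (auto simp: fun_eq_iff space_PiM non_ref_def PiE_iff extensional_def)
  also have "\<dots> = distr (distr ?P ?P ?S) ?R ?emb"
    by (rule distr_distr[OF emb S, symmetric])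
  also have "\<dots> = lebesgue_U G \<delta>"
    by (simp add: distr_PiM_lborel_plus non_ref_def pair_finite_verts lebesgue_U_def)
  finally show ?thesis .
qed

lemma measurable_local_shift:
  assumes "\<delta> \<in> pverts G" "l \<delta> = 0"
  shows "local_shift G l \<in> measurable (lebesgue_Omega G \<delta>) (lebesgue_Omega G \<delta>)"
  unfolding local_shift_def lebesgue_Omega_def case_prod_unfold
  using assms
  by (intro measurable_Pair measurable_compose[OF measurable_fst measurable_translate_U]
        measurable_snd) auto

lemma distr_lebesgue_Omega_local_shift:
  assumes "pair_graph G" "\<delta> \<in> pverts G" "l \<delta> = 0"
  shows "distr (lebesgue_Omega G \<delta>) (lebesgue_Omega G \<delta>) (local_shift G l) = lebesgue_Omega G \<delta>"
proof -
  let ?L = "lebesgue_U G \<delta>" and ?T = "\<lambda>u. \<lambda>i\<in>pverts G. u i + ln (sqrt (1 + l i))"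
  have T: "?T \<in> measurable ?L ?L" and inv: "distr ?L ?L ?T = ?L"
    using assms by (auto intro!: measurable_translate_U distr_lebesgue_U_translate)
  have "sigma_finite_measure (distr ?L ?L (\<lambda>s. s))"
    using sigma_finite_lebesgue_U[OF assms(1,2)] by simp
  from pair_measure_distr[OF T measurable_ident_sets[OF refl] this] show ?thesis
    by (simp add: inv lebesgue_Omega_def local_shift_def)
qed


section \<open>Transformation of the density\<close>

text \<open>
  With \<open>x' = x + ln a\<close> and \<open>y' = y + ln b\<close> the left-hand side is
  \<open>(b\<^sup>2 exp (x' - y') + a\<^sup>2 exp (y' - x')) / 2\<close>; for \<open>a = sqrt (1 + \<lambda>\<^sub>i)\<close> and
  \<open>b = sqrt (1 + \<lambda>\<^sub>j)\<close> the excess coefficients \<open>a\<^sup>2 - 1\<close> and \<open>b\<^sup>2 - 1\<close> are \<open>\<lambda>\<^sub>i\<close> and \<open>\<lambda>\<^sub>j\<close>.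
\<close>

lemma cosh_rescaled:
  fixes a b x y :: real
  assumes "a > 0" "b > 0"
  defines "x' \<equiv> x + ln a" and "y' \<equiv> y + ln b"
  shows "a * b * cosh (x - y)
    = cosh (x' - y') + ((a\<^sup>2 - 1) * exp (y' - x') + (b\<^sup>2 - 1) * exp (x' - y')) / 2"
  using assms by (simp add: cosh_def exp_add exp_diff exp_minus field_simps power2_eq_square)

text \<open>
  All entries, the diagonal ones included, are built from the products
  \<open>W\<^sub>i\<^sub>k exp (u\<^sub>i + u\<^sub>k)\<close>, in which the rescaling of the weight and the shift of \<open>u\<close> cancel.
\<close>

lemma A_matrix_rescaled:
  assumes "\<And>i. i \<in> pverts G \<Longrightarrow> l i > -1"
    and "\<And>i. i \<in> pverts G \<Longrightarrow> u' i = u i + ln (sqrt (1 + l i))"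
    and "i \<in> pverts G" "j \<in> pverts G"
  shows "A_matrix G (rescaled_weights l W) u i j = A_matrix G W u' i j"
proof -
  have "rescaled_weights l W i k * exp (u i + u k) = W i k * exp (u' i + u' k)"
    if "k \<in> pverts G" for k
  proof -
    have "0 < 1 + l i" "0 < 1 + l k" using assms(1)[OF assms(3)] assms(1)[OF that] by auto
    then show ?thesis
      by (simp add: rescaled_weights_def assms(2)[OF assms(3)] assms(2)[OF that] exp_add)
  qed
  then show ?thesis
    using assms(4) by (auto simp: A_matrix_def intro!: sum.cong)
qed

lemma det_on_cong:
  assumes "\<And>i j. i \<in> I \<Longrightarrow> j \<in> I \<Longrightarrow> A i j = B i j"
  shows "det_on I A = det_on I B"
  unfolding det_on_def
  by (intro sum.cong refl arg_cong2[where f = "(*)"] prod.cong) (auto simp: assms permutes_in_image)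

text \<open>
  The \<open>\<beta>\<^sub>i\<close> collect the arcs by their tail; the arcs leaving \<open>\<delta>\<close>, absent on the left, contribute
  nothing on the right as \<open>l\<close> vanishes there.
\<close>

lemma sum_beta_eq_sum_arcs:
  assumes "pair_graph G" "\<delta> \<in> pverts G" "l \<delta> = 0"
  shows "(\<Sum>j\<in>non_ref G \<delta>. l j * beta G W j u)
    = (\<Sum>(i, j)\<in>parcs G. l i * W i j * exp (u j - u i) / 2)"
proof -
  interpret pair_graph G by (rule assms(1))
  have arcs: "parcs G = Sigma (pverts G) (\<lambda>i. {j \<in> pverts G. (i, j) \<in> parcs G})"
    using in_arcsD1 in_arcsD2 by auto
  have "(\<Sum>j\<in>non_ref G \<delta>. l j * beta G W j u) = (\<Sum>i\<in>pverts G. l i * beta G W i u)"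
    by (rule sum.mono_neutral_left) (auto simp: non_ref_def assms pair_finite_verts)
  also have "\<dots> = (\<Sum>i\<in>pverts G. \<Sum>j\<in>{j \<in> pverts G. (i, j) \<in> parcs G}. l i * W i j * exp (u j - u i) / 2)"
    by (simp add: beta_def sum_distrib_left sum_divide_distrib mult.assoc)
  also have "\<dots> = (\<Sum>(i, j)\<in>parcs G. l i * W i j * exp (u j - u i) / 2)"
    by (subst (2) arcs, subst sum.Sigma) (auto simp: pair_finite_verts)
  finally show ?thesis .
qed

definition shift_factor ::
    "'v pair_pre_digraph \<Rightarrow> 'v \<Rightarrow> ('v \<Rightarrow> 'v \<Rightarrow> real) \<Rightarrow> ('v \<Rightarrow> real) \<Rightarrow> ('v \<Rightarrow> real) \<Rightarrow> real" where
  "shift_factor G \<delta> W l u =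
    edge_prod G (\<lambda>i j. exp (rescaled_weights l W i j - W i j))
    * (\<Prod>j\<in>non_ref G \<delta>. sqrt (1 + l j) * exp (- l j * beta G W j u))"

lemma edge_prod_cosh_rescaled:
  assumes G: "pair_graph G" and W: "edge_weights G W"
    and \<delta>: "\<delta> \<in> pverts G" "l \<delta> = 0"
    and l: "\<And>i. i \<in> pverts G \<Longrightarrow> l i > -1"
    and u': "\<And>i. i \<in> pverts G \<Longrightarrow> u' i = u i + ln (sqrt (1 + l i))"
  shows "edge_prod G (\<lambda>i j. exp (- rescaled_weights l W i j * (cosh (u i - u j) - 1)))
    = edge_prod G (\<lambda>i j. exp (- W i j * (cosh (u' i - u' j) - 1)))
      * edge_prod G (\<lambda>i j. exp (rescaled_weights l W i j - W i j))
      * (\<Prod>j\<in>non_ref G \<delta>. exp (- l j * beta G W j u'))"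
proof -
  interpret pair_graph G by (rule G)
  let ?W' = "rescaled_weights l W"
  \<comment> \<open>The symmetric part of the exponent is shared equally by the two arcs, whereas the excess term
      is given entirely to the arc whose tail carries its \<open>\<lambda>\<close>.\<close>
  let ?h = "\<lambda>i j. - W i j * (cosh (u' i - u' j) - 1) / 2 + (?W' i j - W i j) / 2
      - l i * W i j * exp (u' j - u' i) / 2"
  note symW = edge_weights_sym[OF G W] and symW' = rescaled_weights_sym[OF G W]
  have cosh_sym: "cosh (a - b) = cosh (b - a)" for a b :: real
    using cosh_minus[of "a - b"] by simp
  have "edge_prod G (\<lambda>i j. exp (- ?W' i j * (cosh (u i - u j) - 1)))
      = exp (\<Sum>(i, j)\<in>parcs G. ?h i j)"
  proof (rule edge_prod_exp[OF G])
    fix i j assume ij: "(i, j) \<in> parcs G"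
    have pos: "0 < 1 + l i" "0 < 1 + l j"
      using l[OF in_arcsD1[OF ij]] l[OF in_arcsD2[OF ij]] by auto
    have "?W' i j * cosh (u i - u j)
        = W i j * (sqrt (1 + l i) * sqrt (1 + l j) * cosh (u i - u j))"
      by (simp add: rescaled_weights_def)
    also have "\<dots> = W i j * (cosh (u' i - u' j) + (l i * exp (u' j - u' i) + l j * exp (u' i - u' j)) / 2)"
      using pos cosh_rescaled[of "sqrt (1 + l i)" "sqrt (1 + l j)" "u i" "u j"]
      by (simp add: u' in_arcsD1[OF ij] in_arcsD2[OF ij])
    finally have "- ?W' i j * (cosh (u i - u j) - 1) = ?h i j + ?h j i"
      unfolding symW[OF ij, symmetric] symW'[OF ij, symmetric] cosh_sym[of "u' j" "u' i"]
      by (simp add: field_simps)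
    then show "exp (- ?W' i j * (cosh (u i - u j) - 1)) = exp (?h i j + ?h j i)" by simp
  qed
  also have "\<dots> = exp (\<Sum>(i, j)\<in>parcs G. - W i j * (cosh (u' i - u' j) - 1) / 2)
      * exp (\<Sum>(i, j)\<in>parcs G. (?W' i j - W i j) / 2)
      * exp (- (\<Sum>(i, j)\<in>parcs G. l i * W i j * exp (u' j - u' i) / 2))"
    by (simp add: case_prod_unfold sum.distrib sum_subtractf sum_negf flip: exp_add)
  also have "exp (\<Sum>(i, j)\<in>parcs G. - W i j * (cosh (u' i - u' j) - 1) / 2)
      = edge_prod G (\<lambda>i j. exp (- W i j * (cosh (u' i - u' j) - 1)))"
    using symW cosh_sym by (subst edge_prod_exp_symmetric[OF G]) metis+
  also have "exp (\<Sum>(i, j)\<in>parcs G. (?W' i j - W i j) / 2) = edge_prod G (\<lambda>i j. exp (?W' i j - W i j))"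
    using symW symW' by (subst edge_prod_exp_symmetric[OF G]) metis+
  also have "exp (- (\<Sum>(i, j)\<in>parcs G. l i * W i j * exp (u' j - u' i) / 2))
      = (\<Prod>j\<in>non_ref G \<delta>. exp (- l j * beta G W j u'))"
    using \<delta> by (simp add: sum_beta_eq_sum_arcs[OF G, symmetric] exp_sum[symmetric] non_ref_def
        pair_finite_verts sum_negf)
  finally show ?thesis .
qed

lemma H22_density_rescaled:
  assumes G: "pair_graph G" and W: "edge_weights G W"
    and \<delta>: "\<delta> \<in> pverts G" "l \<delta> = 0"
    and l: "\<And>i. i \<in> pverts G \<Longrightarrow> l i > -1"
    and u': "\<And>i. i \<in> pverts G \<Longrightarrow> u' i = u i + ln (sqrt (1 + l i))"
  shows "H22_density G \<delta> (rescaled_weights l W) (u, s)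
    = H22_density G \<delta> W (u', s) * shift_factor G \<delta> W l u'"
proof -
  note A = A_matrix_rescaled[where l = l and u = u and u' = u' and G = G and W = W, OF l u']
  have det: "det_on (non_ref G \<delta>) (A_matrix G (rescaled_weights l W) u)
      = det_on (non_ref G \<delta>) (A_matrix G W u')"
    by (rule det_on_cong) (simp add: A non_ref_def)
  have "exp (- u i) / (2 * pi) = exp (- u' i) / (2 * pi) * sqrt (1 + l i)" if "i \<in> non_ref G \<delta>" for i
    using that l[of i] u'[of i] by (simp add: non_ref_def exp_diff exp_minus field_simps exp_add)
  then have jac: "(\<Prod>i\<in>non_ref G \<delta>. exp (- u i) / (2 * pi))
      = (\<Prod>i\<in>non_ref G \<delta>. exp (- u' i) / (2 * pi)) * (\<Prod>i\<in>non_ref G \<delta>. sqrt (1 + l i))"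
    by (simp add: prod.distrib[symmetric])
  have edges: "edge_prod G (\<lambda>i j. exp (- rescaled_weights l W i j * (cosh (u i - u j) - 1)))
    = edge_prod G (\<lambda>i j. exp (- W i j * (cosh (u' i - u' j) - 1)))
      * edge_prod G (\<lambda>i j. exp (rescaled_weights l W i j - W i j))
      * (\<Prod>j\<in>non_ref G \<delta>. exp (- l j * beta G W j u'))"
    by (rule edge_prod_cosh_rescaled) (use assms in auto)
  show ?thesis
    unfolding H22_density_def shift_factor_def prod.distrib prod.case det jac edges
    by (simp add: A mult_ac)
qed


section \<open>Measurability\<close>

lemma measurable_coordinates_lebesgue_Omega [measurable]:
  assumes "i \<in> pverts G"
  shows "(\<lambda>x. fst x i) \<in> borel_measurable (lebesgue_Omega G \<delta>)"
    and "(\<lambda>x. snd x i) \<in> borel_measurable (lebesgue_Omega G \<delta>)"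
  unfolding lebesgue_Omega_def using assms
  by (auto intro: measurable_compose[OF measurable_fst] measurable_compose[OF measurable_snd]
      measurable_component_lebesgue_U)

text \<open>
  The edge product is first rewritten as the exponential of a sum over arcs, because the definite
  description inside it has no evident measurability.
\<close>

lemma borel_measurable_H22_density:
  assumes G: "pair_graph G" and W: "edge_weights G W"
  shows "H22_density G \<delta> W \<in> borel_measurable (lebesgue_Omega G \<delta>)"
proof -
  interpret pair_graph G by (rule G)
  let ?M = "lebesgue_Omega G \<delta>"
  have A: "(\<lambda>x. A_matrix G W (fst x) i j) \<in> borel_measurable ?M"
    if "i \<in> pverts G" "j \<in> pverts G" for i j
    using that unfolding A_matrix_def by measurable
  have quad: "(\<lambda>x. \<Sum>i\<in>pverts G. \<Sum>j\<in>pverts G. snd x i * A_matrix G W (fst x) i j * snd x j)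
      \<in> borel_measurable ?M"
    by (intro borel_measurable_sum borel_measurable_times A measurable_coordinates_lebesgue_Omega)
  have det: "(\<lambda>x. det_on (non_ref G \<delta>) (A_matrix G W (fst x))) \<in> borel_measurable ?M"
    unfolding det_on_def
    by (intro borel_measurable_sum borel_measurable_times borel_measurable_const
        borel_measurable_prod A) (auto simp: non_ref_def dest: permutes_in_image)
  have "cosh (a - b) = cosh (b - a)" for a b :: real
    using cosh_minus[of "a - b"] by simp
  then have edge: "edge_prod G (\<lambda>i j. exp (- W i j * (cosh (u i - u j) - 1)))
      = exp (\<Sum>(i, j)\<in>parcs G. - W i j * (cosh (u i - u j) - 1) / 2)" for u
    using edge_weights_sym[OF G W] by (subst edge_prod_exp_symmetric[OF G]) metis+
  have "(\<lambda>x. cosh (fst x i - fst x j)) \<in> borel_measurable ?M"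
    if "i \<in> pverts G" "j \<in> pverts G" for i j
    using that unfolding cosh_def by measurable
  then have edges: "(\<lambda>x. \<Sum>(i, j)\<in>parcs G. - W i j * (cosh (fst x i - fst x j) - 1) / 2)
      \<in> borel_measurable ?M"
    unfolding case_prod_unfold
    by (intro borel_measurable_sum borel_measurable_times borel_measurable_const
        borel_measurable_divide borel_measurable_diff) (auto simp: arc_fst_in_verts arc_snd_in_verts)
  have jac: "(\<lambda>x. \<Prod>i\<in>non_ref G \<delta>. exp (- fst x i) / (2 * pi)) \<in> borel_measurable ?M"
    by (intro borel_measurable_prod) (simp add: non_ref_def)
  show ?thesis
    unfolding H22_density_def case_prod_unfold edge
    using quad det edges jac unfolding case_prod_unfold by measurable
qed

lemma borel_measurable_shift_factor:
  assumes G: "pair_graph G"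
  shows "(\<lambda>x. shift_factor G \<delta> W l (fst x)) \<in> borel_measurable (lebesgue_Omega G \<delta>)"
proof -
  have "(\<lambda>x. beta G W i (fst x)) \<in> borel_measurable (lebesgue_Omega G \<delta>)" if "i \<in> pverts G" for i
    using that unfolding beta_def
    by (intro borel_measurable_times borel_measurable_const borel_measurable_sum) simp
  then show ?thesis
    unfolding shift_factor_def
    by (intro borel_measurable_times borel_measurable_const borel_measurable_prod
        borel_measurable_exp[THEN measurable_compose[rotated]]) (auto simp: non_ref_def)
qed

lemma edge_prod_rescaling_nonneg:
  assumes "pair_graph G" "edge_weights G W"
  shows "0 \<le> edge_prod G (\<lambda>i j. exp (rescaled_weights l W i j - W i j))"
  using edge_weights_sym[OF assms] rescaled_weights_sym[OF assms]
  by (subst edge_prod_exp_symmetric[OF assms(1)]) (metis, simp)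

lemma shift_factor_nonneg:
  assumes "pair_graph G" "edge_weights G W" "\<And>i. i \<in> pverts G \<Longrightarrow> l i > -1"
  shows "0 \<le> shift_factor G \<delta> W l u"
  unfolding shift_factor_def
  using assms(3)
  by (intro mult_nonneg_nonneg edge_prod_rescaling_nonneg[OF assms(1,2)] prod_nonneg)
     (force simp: non_ref_def, simp)


section \<open>The image of the measure\<close>

theorem theorem3p1:
  fixes G :: "'v pair_pre_digraph" and \<delta> :: 'v
    and W :: "'v \<Rightarrow> 'v \<Rightarrow> real" and l :: "'v \<Rightarrow> real"
  assumes "pair_graph G" and "Digraph_Component.connected (with_proj G)"
    and "\<delta> \<in> pverts G"
    and "edge_weights G W"
    and "l \<in> shift_params G \<delta>"
  shows "distr (H22_measure G \<delta> (rescaled_weights l W)) (lebesgue_Omega G \<delta>) (local_shift G l)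
      = density (H22_measure G \<delta> W) (\<lambda>(u, s). ennreal (
          edge_prod G (\<lambda>i j. exp (rescaled_weights l W i j - W i j))
          * (\<Prod>j\<in>non_ref G \<delta>. sqrt (1 + l j) * exp (- l j * beta G W j u))))
    \<and> density (H22_measure G \<delta> W) (\<lambda>(u, s). ennreal (
          edge_prod G (\<lambda>i j. exp (rescaled_weights l W i j - W i j))
          * (\<Prod>j\<in>non_ref G \<delta>. sqrt (1 + l j) * exp (- l j * beta G W j u))))
      = density (H22_measure G \<delta> W) (\<lambda>(u, s). ennreal (
          edge_prod G (\<lambda>i j. exp (W i j * (sqrt (1 + l i) * sqrt (1 + l j) - 1)))
          * (\<Prod>j\<in>non_ref G \<delta>. sqrt (1 + l j) * exp (- l j * beta G W j u))))"
proof (intro conjI)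
  have \<delta>: "\<delta> \<in> pverts G" "l \<delta> = 0" and l: "\<And>i. i \<in> pverts G \<Longrightarrow> l i > -1"
    using assms(3,5) by (auto simp: shift_params_def PiE_iff)
  let ?M = "lebesgue_Omega G \<delta>"
  let ?g = "\<lambda>x. ennreal (H22_density G \<delta> W x) * ennreal (shift_factor G \<delta> W l (fst x))"
  note H = borel_measurable_H22_density[OF assms(1,4), of \<delta>]
    and F = borel_measurable_shift_factor[OF assms(1), of \<delta> W l]
  have "ennreal (H22_density G \<delta> (rescaled_weights l W) x) = ?g (local_shift G l x)" for x
  proof (cases x)
    case (Pair u s)
    let ?u' = "\<lambda>i\<in>pverts G. u i + ln (sqrt (1 + l i))"
    have "H22_density G \<delta> (rescaled_weights l W) (u, s)
        = H22_density G \<delta> W (?u', s) * shift_factor G \<delta> W l ?u'"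
      using assms(1,4) \<delta> l by (intro H22_density_rescaled) auto
    moreover have "0 \<le> shift_factor G \<delta> W l ?u'"
      using assms(1,4) l by (intro shift_factor_nonneg)
    ultimately show ?thesis
      by (simp add: Pair local_shift_def ennreal_mult'')
  qed
  then have "distr (H22_measure G \<delta> (rescaled_weights l W)) ?M (local_shift G l)
      = distr (density ?M (\<lambda>x. ?g (local_shift G l x))) ?M (local_shift G l)"
    by (simp add: H22_measure_def)
  also have "\<dots> = density (distr ?M ?M (local_shift G l)) ?g"
    using H F by (intro density_distr[symmetric] measurable_local_shift \<delta>) auto
  also have "\<dots> = density ?M ?g"
    by (simp add: distr_lebesgue_Omega_local_shift[where l = l, OF assms(1) \<delta>])
  also have "\<dots> = density (H22_measure G \<delta> W) (\<lambda>x. ennreal (shift_factor G \<delta> W l (fst x)))"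
    using H F by (simp add: H22_measure_def density_density_eq)
  finally show "distr (H22_measure G \<delta> (rescaled_weights l W)) ?M (local_shift G l)
      = density (H22_measure G \<delta> W) (\<lambda>(u, s). ennreal (
          edge_prod G (\<lambda>i j. exp (rescaled_weights l W i j - W i j))
          * (\<Prod>j\<in>non_ref G \<delta>. sqrt (1 + l j) * exp (- l j * beta G W j u))))"
    by (simp add: shift_factor_def case_prod_unfold)
  have "rescaled_weights l W i j - W i j = W i j * (sqrt (1 + l i) * sqrt (1 + l j) - 1)" for i j
    by (simp add: rescaled_weights_def algebra_simps)
  then show "density (H22_measure G \<delta> W) (\<lambda>(u, s). ennreal (
          edge_prod G (\<lambda>i j. exp (rescaled_weights l W i j - W i j))
          * (\<Prod>j\<in>non_ref G \<delta>. sqrt (1 + l j) * exp (- l j * beta G W j u))))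
      = density (H22_measure G \<delta> W) (\<lambda>(u, s). ennreal (
          edge_prod G (\<lambda>i j. exp (W i j * (sqrt (1 + l i) * sqrt (1 + l j) - 1)))
          * (\<Prod>j\<in>non_ref G \<delta>. sqrt (1 + l j) * exp (- l j * beta G W j u))))"
    by simp
qed

end
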